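(* Let $K$ be a field and let $(\mathcal{H},[\cdot,\cdot],\alpha)$ be a finite-dimensional Heisenberg Hom-Lie algebra over $K$. Then there are an integer $m\ge1$, a basis $(x_1,\dots,x_m,y_1,\dots,y_m,z)$ of $\mathcal{H}$ and $\lambda\in K$ such that: (i) $[x_k,y_k]=z=-[y_k,x_k]$ for $k=1,\dots,m$, and all other brackets of basis elements are zero; (ii) the matrix of $\alpha$ in this basis is of the form $$P=\begin{bmatrix}X&T&0\\Z&Y&0\\L&M&\lambda\end{bmatrix},$$ with $X,T,Z,Y\in M_m(K)$ and $L,M\in M_{1,m}(K)$, where the $2m\times 2m$ matrix $\begin{bmatrix}X&T\\Z&Y\end{bmatrix}$ is $\lambda$-symplectic.
   Context: Matrices of linear maps act on column vectors (columns are images of basis vectors). A Hom-Lie algebra is a triple $(\mathcal{G},[\cdot,\cdot],\alpha)$ with $\mathcal{G}$ a $K$-vector space, $[\cdot,\cdot]:\mathcal{G}\times\mathcal{G}\to\mathcal{G}$ bilinear with $[x,y]=-[y,x]$, and $\alpha:\mathcal{G}\to\mathcal{G}$ linear, such that $[\alpha(x),[y,w]]+[\alpha(y),[w,x]]+[\alpha(w),[x,y]]=0$ for all $x,y,w$. It is multiplicative if $\alpha([x,y])=[\alpha(x),\alpha(y)]$ for all $x,y$. Its center is $Z(\mathcal{G})=\{x:[x,y]=0\ \forall y\}$. It is nilpotent if the series $\mathcal{G}_0=\mathcal{G}$, $\mathcal{G}_{n+1}=[\mathcal{G},\mathcal{G}_n]$ reaches $\{0\}$. A Heisenberg Hom-Lie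 algebra is a multiplicative nilpotent Hom-Lie algebra $\mathcal{H}$ with $\dim[\mathcal{H},\mathcal{H}]=1$ and $[\mathcal{H},\mathcal{H}]=Z(\mathcal{H})$. A matrix $S\in M_{2m}(K)$ is $\lambda$-symplectic if ${}^tS\,B\,S=\lambda B$, where $B=\begin{bmatrix}0&I_m\\-I_m&0\end{bmatrix}$.
   Formalization: In characteristic 2 the bracket is additionally assumed to satisfy [v,v]=0 for all v; without this the claim fails, e.g. for H=span(x,z) with [x,x]=z, all other brackets zero and α=0, which has even dimension 2. *)

theory Defs
  imports "Jordan_Normal_Form.Matrix"
begin

definition symplectic_form_mat :: "nat \<Rightarrow> 'k::field mat" where
  "symplectic_form_mat m = four_block_mat (0\<^sub>m m m) (1\<^sub>m m) (- 1\<^sub>m m) (0\<^sub>m m m)"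

definition lambda_symplectic :: "nat \<Rightarrow> 'k::field \<Rightarrow> 'k mat \<Rightarrow> bool" where
  "lambda_symplectic m l S \<longleftrightarrow> S \<in> carrier_mat (2 * m) (2 * m) \<and>
     transpose_mat S * symplectic_form_mat m * S = l \<cdot>\<^sub>m symplectic_form_mat m"

context vector_space
begin

definition ordered_basis :: "'b list \<Rightarrow> bool" where
  "ordered_basis bs \<longleftrightarrow> distinct bs \<and> independent (set bs) \<and> span (set bs) = UNIV"

text \<open>Column \<open>j\<close> holds the coordinates of the image of the \<open>j\<close>-th basis vector.\<close>

definition is_matrix_of :: "'b list \<Rightarrow> ('b \<Rightarrow> 'b) \<Rightarrow> 'a mat \<Rightarrow> bool" where
  "is_matrix_of bs f A \<longleftrightarrow> A \<in> carrier_mat (length bs) (length bs) \<and>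
     (\<forall>j<length bs. f (bs ! j) = (\<Sum>i<length bs. scale (A $$ (i, j)) (bs ! i)))"

end

text \<open>Skew-symmetry is \<open>[x, y] = - [y, x]\<close>; in characteristic 2 this does not make the bracket
  alternating.\<close>

locale hom_lie_algebra = vector_space scale
  for scale :: "'k::field \<Rightarrow> 'v::ab_group_add \<Rightarrow> 'v" +
  fixes br :: "'v \<Rightarrow> 'v \<Rightarrow> 'v" and \<alpha> :: "'v \<Rightarrow> 'v"
  assumes linear_br_right: "Vector_Spaces.linear scale scale (\<lambda>y. br x y)"
    and linear_br_left: "Vector_Spaces.linear scale scale (\<lambda>x. br x y)"
    and br_skew: "br x y = - br y x"
    and linear_\<alpha>: "Vector_Spaces.linear scale scale \<alpha>"
    and hom_jacobi: "br (\<alpha> x) (br y w) + br (\<alpha> y) (br w x) + br (\<alpha> w) (br x y) = 0"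
begin

definition bracket_space :: "'v set \<Rightarrow> 'v set \<Rightarrow> 'v set" where
  "bracket_space A B = span {br a b | a b. a \<in> A \<and> b \<in> B}"

definition center :: "'v set" where
  "center = {x. \<forall>y. br x y = 0}"

primrec lower_central_series :: "nat \<Rightarrow> 'v set" where
  "lower_central_series 0 = UNIV"
| "lower_central_series (Suc n) = bracket_space UNIV (lower_central_series n)"

definition nilpotent :: bool where
  "nilpotent \<longleftrightarrow> (\<exists>n. lower_central_series n = {0})"

end

locale multiplicative_hom_lie_algebra = hom_lie_algebra +
  assumes \<alpha>_br: "\<alpha> (br x y) = br (\<alpha> x) (\<alpha> y)"

locale heisenberg_hom_lie_algebra = multiplicative_hom_lie_algebra +
  assumes nilpotent: nilpotent
    and dim_derived: "dim (bracket_space UNIV UNIV) = 1"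
    and derived_eq_center: "bracket_space UNIV UNIV = center"

end

theory Submission
  imports Defs
begin

text \<open>
  The bracket has the form \<open>[u, v] = \<omega>(u, v) z\<close>, where \<open>z\<close> spans the derived algebra and \<open>\<omega>\<close> is an
  alternating form whose radical is the line of \<open>z\<close>. A symplectic family of maximal size together
  with \<open>z\<close> spans the whole space: subtracting from a vector its components along the family leaves a
  vector orthogonal to the family, and if this were outside the radical, the family could be
  extended. Multiplicativity gives \<open>\<alpha> z = \<lambda> z\<close> and \<open>\<omega>(\<alpha> u, \<alpha> v) = \<lambda> \<omega>(u, v)\<close>, which in coordinates
  is \<open>\<lambda>\<close>-symplecticity.
\<close>

section \<open>Linear algebra of lists of vectors and of lines\<close>

lemma sum_lessThan_add:
  fixes f :: "nat \<Rightarrow> 'a::comm_monoid_add"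
  shows "(\<Sum>i<m + n. f i) = (\<Sum>i<m. f i) + (\<Sum>i<n. f (m + i))"
  by (induction n) (simp_all add: add.assoc)

context vector_space
begin

text \<open>The coefficients are indexed by positions, not by vectors, so a repeated vector already
  yields a nontrivial relation, with coefficients 1 and -1. This is why distinctness comes along
  with independence.\<close>

lemma independent_listI:
  assumes coeff: "\<And>c. (\<Sum>i<length bs. c i *s bs ! i) = 0 \<Longrightarrow> \<forall>i<length bs. c i = 0"
  shows "distinct bs" and "independent (set bs)"
proof -
  show dist: "distinct bs"
  proof (rule ccontr)
    assume "\<not> distinct bs"
    then obtain p q where pq: "p < length bs" "q < length bs" "p \<noteq> q" "bs ! p = bs ! q"
      by (auto simp: distinct_conv_nth)
    let ?c = "\<lambda>i. if i = p then 1 else if i = q then - 1 else (0::'a)"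
    have "(\<Sum>i<length bs. ?c i *s bs ! i) = (\<Sum>i\<in>{p, q}. ?c i *s bs ! i)"
      using pq by (intro sum.mono_neutral_right) auto
    also have "\<dots> = 0"
      using pq by simp
    finally show False
      using coeff[of ?c] pq(1) by (metis zero_neq_one)
  qed
  show "independent (set bs)"
  proof (rule independent_if_scalars_zero)
    fix f v
    assume zero: "(\<Sum>v\<in>set bs. f v *s v) = 0" and v: "v \<in> set bs"
    have "(\<Sum>v\<in>set bs. f v *s v) = (\<Sum>i<length bs. f (bs ! i) *s bs ! i)"
      using sum.reindex_bij_betw[OF bij_betw_nth[OF dist refl refl], of "\<lambda>v. f v *s v"] by simp
    with zero coeff[of "\<lambda>i. f (bs ! i)"] v show "f v = 0"
      by (auto simp: in_set_conv_nth)
  qed simp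
qed

text \<open>An infinite set has \<open>card\<close> 0, so \<open>dim V = 1\<close> forces a
  singleton basis without any appeal to finite dimension.\<close>

lemma dim_eq_one_obtains:
  assumes "dim V = 1" and "subspace V"
  obtains z where "z \<noteq> 0" and "V = span {z}"
proof -
  obtain B where B: "B \<subseteq> V" "independent B" "V \<subseteq> span B" "card B = dim V"
    using basis_exists by metis
  then obtain z where z: "B = {z}"
    using assms(1) card_1_singletonE by metis
  have "z \<noteq> 0"
    using B(2) z dependent_zero by auto
  moreover have "V = span {z}"
    using B(1,3) z assms(2) span_minimal by blast
  ultimately show ?thesis
    by (rule that)
qed

end

section \<open>Alternating forms and symplectic families\<close>

locale alternating_form = vector_space scale
  for scale :: "'k::field \<Rightarrow> 'v::ab_group_add \<Rightarrow> 'v" (infixr \<open>*s\<close> 75) +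
  fixes \<omega> :: "'v \<Rightarrow> 'v \<Rightarrow> 'k"
  assumes add_left: "\<omega> (u + v) w = \<omega> u w + \<omega> v w"
    and add_right: "\<omega> u (v + w) = \<omega> u v + \<omega> u w"
    and scale_left: "\<omega> (c *s u) v = c * \<omega> u v"
    and scale_right: "\<omega> u (c *s v) = c * \<omega> u v"
    and self: "\<omega> v v = 0"
begin

text \<open>Polarization of \<open>self\<close>. The converse fails in characteristic 2, hence the
  choice of \<open>self\<close> as the axiom.\<close>

lemma skew: "\<omega> u v = - \<omega> v u"
proof -
  have "\<omega> u v + \<omega> v u = 0"
    using self[of "u + v"] unfolding add_left add_right by (simp add: self add.commute)
  then show ?thesis
    by (simp add: eq_neg_iff_add_eq_0)
qed

lemma zero_left: "\<omega> 0 v = 0"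
  using scale_left[of 0] by simp

lemma diff_left: "\<omega> (u - v) w = \<omega> u w - \<omega> v w"
  using add_left[of "u - v" v w] by simp

lemma sum_left: "\<omega> (\<Sum>i\<in>A. f i) v = (\<Sum>i\<in>A. \<omega> (f i) v)"
  by (induction A rule: infinite_finite_induct) (simp_all add: zero_left add_left)

text \<open>The products \<open>\<omega> (y i) (x j)\<close> are left to skew-symmetry. Only values
  at indices below \<open>m\<close> are constrained, so a family can be extended by function update
  at \<open>m\<close>.\<close>

definition symplectic_family :: "nat \<Rightarrow> (nat \<Rightarrow> 'v) \<Rightarrow> (nat \<Rightarrow> 'v) \<Rightarrow> bool" where
  "symplectic_family m x y \<longleftrightarrow>
    (\<forall>i<m. \<forall>j<m. \<omega> (x i) (x j) = 0 \<and> \<omega> (y i) (y j) = 0 \<and> \<omega> (x i) (y j) = of_bool (i = j))"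

lemma symplectic_familyD:
  assumes "symplectic_family m x y" and "i < m" and "j < m"
  shows "\<omega> (x i) (x j) = 0" and "\<omega> (y i) (y j) = 0"
    and "\<omega> (x i) (y j) = of_bool (i = j)" and "\<omega> (y i) (x j) = - of_bool (i = j)"
  using assms skew[of "y i" "x j"] by (auto simp: symplectic_family_def)

text \<open>By duality, pairing with a member of the family isolates the coefficient of its partner.
  This yields both the coefficients of the projection and linear independence.\<close>

lemma form_combination:
  assumes fam: "symplectic_family m x y" and "k < m"
  shows "\<omega> (\<Sum>i<m. a i *s x i + b i *s y i) (y k) = a k"
    and "\<omega> (\<Sum>i<m. a i *s x i + b i *s y i) (x k) = - b k"
proof -
  have "\<omega> (\<Sum>i<m. a i *s x i + b i *s y i) (y k) = (\<Sum>i<m. if i = k then a k else 0)"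
    unfolding sum_left
    by (rule sum.cong) (use assms(2) in \<open>auto simp: add_left scale_left symplectic_familyD[OF fam]\<close>)
  then show "\<omega> (\<Sum>i<m. a i *s x i + b i *s y i) (y k) = a k"
    using assms(2) by simp
  have "\<omega> (\<Sum>i<m. a i *s x i + b i *s y i) (x k) = (\<Sum>i<m. if i = k then - b k else 0)"
    unfolding sum_left
    by (rule sum.cong) (use assms(2) in \<open>auto simp: add_left scale_left symplectic_familyD[OF fam]\<close>)
  then show "\<omega> (\<Sum>i<m. a i *s x i + b i *s y i) (x k) = - b k"
    using assms(2) by simp
qed

text \<open>These are the coefficients that \<open>form_combination\<close> forces on a vector in
  the span of the family, so this is the projection onto that span along its orthogonal complement.
  The minus sign sits inside the coefficient to match that lemma.\<close>

definition family_proj :: "nat \<Rightarrow> (nat \<Rightarrow> 'v) \<Rightarrow> (nat \<Rightarrow> 'v) \<Rightarrow> 'v \<Rightarrow> 'v" where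
  "family_proj m x y v = (\<Sum>i<m. \<omega> v (y i) *s x i + (- \<omega> v (x i)) *s y i)"

lemma proj_complement_orthogonal:
  assumes "symplectic_family m x y" and "k < m"
  shows "\<omega> (v - family_proj m x y v) (x k) = 0" and "\<omega> (v - family_proj m x y v) (y k) = 0"
    and "\<omega> (x k) (v - family_proj m x y v) = 0" and "\<omega> (y k) (v - family_proj m x y v) = 0"
proof -
  show 1: "\<omega> (v - family_proj m x y v) (x k) = 0" "\<omega> (v - family_proj m x y v) (y k) = 0"
    unfolding diff_left family_proj_def by (simp_all only: form_combination[OF assms]) simp_all
  show "\<omega> (x k) (v - family_proj m x y v) = 0" "\<omega> (y k) (v - family_proj m x y v) = 0"
    using 1 skew[of "x k"] skew[of "y k"] by simp_all
qed

text \<open>A step of symplectic Gram-Schmidt. The new pair is \<open>v\<close> and a multiple of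
  \<open>w\<close> minus its projection. Since \<open>v\<close> is orthogonal to the family, this
  correction keeps the product with \<open>v\<close> nonzero, and rescaling makes it 1.\<close>

lemma symplectic_family_extend:
  assumes fam: "symplectic_family m x y"
    and orth: "\<And>k. k < m \<Longrightarrow> \<omega> v (x k) = 0 \<and> \<omega> v (y k) = 0"
    and nonzero: "\<omega> v w \<noteq> 0"
  shows "\<exists>x' y'. symplectic_family (Suc m) x' y'"
proof -
  define w' where "w' = w - family_proj m x y w"
  have orth_v: "\<omega> (x k) v = 0" "\<omega> (y k) v = 0" if "k < m" for k
    using orth[OF that] skew[of "x k" v] skew[of "y k" v] by simp_all
  then have "\<omega> (family_proj m x y w) v = 0"
    by (simp add: family_proj_def sum_left diff_left scale_left)
  then have "\<omega> w' v = \<omega> w v"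
    by (simp add: w'_def diff_left)
  then have vw': "\<omega> v w' \<noteq> 0"
    using nonzero skew[of v] by simp
  have orth': "\<omega> (x k) w' = 0" "\<omega> (y k) w' = 0" "\<omega> w' (x k) = 0" "\<omega> w' (y k) = 0"
    "\<omega> (x k) v = 0" "\<omega> (y k) v = 0" "\<omega> v (x k) = 0" "\<omega> v (y k) = 0" if "k < m" for k
    using proj_complement_orthogonal[OF fam that] orth[OF that] orth_v[OF that] by (simp_all add: w'_def)
  have "symplectic_family (Suc m) (x(m := v)) (y(m := inverse (\<omega> v w') *s w'))"
    using vw' by (auto simp: symplectic_family_def less_Suc_eq self scale_left scale_right orth'
        symplectic_familyD[OF fam])
  then show ?thesis
    by blast
qed

text \<open>Pairing a linear relation with any vector removes the term in \<open>z\<close>, so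
  \<open>form_combination\<close> kills all other coefficients; what remains is a multiple of
  \<open>z\<close>.\<close>

lemma independent_symplectic_family:
  assumes fam: "symplectic_family m x y" and rad: "\<And>v. \<omega> z v = 0" and "z \<noteq> 0"
  defines "bs \<equiv> map x [0..<m] @ map y [0..<m] @ [z]"
  shows "distinct bs" and "independent (set bs)"
proof -
  have all_zero: "\<forall>i<length bs. c i = 0" if zero: "(\<Sum>i<length bs. c i *s bs ! i) = 0" for c
  proof -
    let ?s = "\<Sum>i<m. c i *s x i + c (m + i) *s y i"
    \<comment> \<open>The length is bracketed so that \<open>sum_lessThan_add\<close>, applied
      twice, splits the sum into its parts over \<open>x\<close>, \<open>y\<close> and
      \<open>z\<close>.\<close>
    have len: "length bs = m + (m + 1)"
      by (simp add: bs_def)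
    have eq: "?s + c (m + m) *s z = 0"
      using zero unfolding len sum_lessThan_add by (simp add: bs_def nth_append sum.distrib add.assoc)
    have "\<omega> (?s + c (m + m) *s z) v = \<omega> ?s v" for v
      by (simp add: add_left scale_left rad)
    then have orth: "\<omega> ?s v = 0" for v
      by (simp only: eq zero_left)
    have c: "c k = 0 \<and> c (m + k) = 0" if "k < m" for k
      using orth[of "y k"] orth[of "x k"] form_combination[OF fam that] by simp
    then have "?s = 0"
      by (simp add: sum.neutral)
    with eq have "c (m + m) = 0"
      using \<open>z \<noteq> 0\<close> by simp
    moreover have "i < m \<or> (\<exists>k<m. i = m + k) \<or> i = m + m" if "i < length bs" for i
      using that len by presburger
    ultimately show ?thesis
      using c by blast
  qed
  show "distinct bs" "independent (set bs)"
    using independent_listI all_zero by blast+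
qed

lemma symplectic_basis_exists:
  assumes "finite B" and "span B = UNIV"
    and rad: "{u. \<forall>v. \<omega> u v = 0} = span {z}" and "z \<noteq> 0"
  obtains m x y where "symplectic_family m x y"
    and "\<And>v. \<exists>c. v = family_proj m x y v + c *s z"
proof -
  have z: "\<omega> z v = 0" for v
    using rad span_base[of z "{z}"] by blast
  \<comment> \<open>Together with \<open>z\<close> a family is independent, so its size is bounded
    and a largest one exists.\<close>
  have bound: "m \<le> card B" if "\<exists>x y. symplectic_family m x y" for m
  proof -
    from that obtain x y where fam: "symplectic_family m x y"
      by blast
    let ?bs = "map x [0..<m] @ map y [0..<m] @ [z]"
    note ind = independent_symplectic_family[OF fam z \<open>z \<noteq> 0\<close>]
    have "card (set ?bs) \<le> card B"
      using independent_span_bound[OF assms(1) ind(2)] assms(2) by simp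
    moreover have "card (set ?bs) = m + m + 1"
      using distinct_card[OF ind(1)] by simp
    ultimately show ?thesis
      by linarith
  qed
  have "\<exists>x y. symplectic_family 0 x y"
    by (simp add: symplectic_family_def)
  then obtain m where "\<exists>x y. symplectic_family m x y"
    and max: "\<And>n. \<exists>x y. symplectic_family n x y \<Longrightarrow> n \<le> m"
    using Nat.ex_has_greatest_nat[of "\<lambda>m. \<exists>x y. symplectic_family m x y" 0 "card B"] bound
    by blast
  then obtain x y where fam: "symplectic_family m x y"
    by blast
  have "\<exists>c. v = family_proj m x y v + c *s z" for v
  proof -
    let ?u = "v - family_proj m x y v"
    have "\<omega> ?u w = 0" for w
      using symplectic_family_extend[OF fam, of ?u w] proj_complement_orthogonal(1,2)[OF fam]
        max[of "Suc m"] by fastforce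
    then have "?u \<in> span {z}"
      using rad by blast
    then obtain c where "?u = c *s z"
      by (auto simp: span_singleton)
    then show ?thesis
      by (metis add.commute diff_add_cancel)
  qed
  with fam show ?thesis
    by (rule that)
qed

lemma ordered_basis_symplectic_family:
  assumes fam: "symplectic_family m x y" and rad: "\<And>v. \<omega> z v = 0" and "z \<noteq> 0"
    and expand: "\<And>v. \<exists>c. v = family_proj m x y v + c *s z"
  shows "ordered_basis (map x [0..<m] @ map y [0..<m] @ [z])"
proof -
  let ?bs = "map x [0..<m] @ map y [0..<m] @ [z]"
  have "v \<in> span (set ?bs)" for v
  proof -
    obtain c where "v = family_proj m x y v + c *s z"
      using expand by blast
    moreover have "family_proj m x y v + c *s z \<in> span (set ?bs)"
      unfolding family_proj_def
      by (intro span_add span_sum span_scale span_base) auto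
    ultimately show ?thesis
      by simp
  qed
  then show ?thesis
    using independent_symplectic_family[OF fam rad \<open>z \<noteq> 0\<close>] by (auto simp: ordered_basis_def)
qed

text \<open>The \<open>z\<close>-component of \<open>u\<close> lies in the radical, so only the
  projection contributes. The formula shows that the form vanishes if \<open>m = 0\<close>, and on
  images under \<open>\<alpha>\<close> it produces the entries of the symplectic condition.\<close>

lemma form_expand:
  assumes rad: "\<And>v. \<omega> z v = 0" and expand: "\<And>v. \<exists>c. v = family_proj m x y v + c *s z"
  shows "\<omega> u v = (\<Sum>i<m. \<omega> u (x i) * \<omega> v (y i) - \<omega> u (y i) * \<omega> v (x i))"
proof -
  obtain c where "u = family_proj m x y u + c *s z"
    using expand by blast
  then have "\<omega> u v = \<omega> (family_proj m x y u) v"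
    by (metis add_left scale_left rad mult_zero_right add.right_neutral)
  also have "\<dots> = (\<Sum>i<m. \<omega> u (x i) * \<omega> v (y i) - \<omega> u (y i) * \<omega> v (x i))"
    unfolding family_proj_def sum_left
    by (rule sum.cong) (simp_all add: diff_left scale_left skew[of "x _" v] skew[of "y _" v])
  finally show ?thesis .
qed

end

section \<open>The symplectic condition as one equation per block\<close>

lemma lambda_symplectic_four_blockI:
  assumes carrier: "X \<in> carrier_mat m m" "T \<in> carrier_mat m m"
      "Z \<in> carrier_mat m m" "Y \<in> carrier_mat m m"
    and "transpose_mat X * Z - transpose_mat Z * X = 0\<^sub>m m m"
    and "transpose_mat X * Y - transpose_mat Z * T = l \<cdot>\<^sub>m 1\<^sub>m m"
    and "transpose_mat T * Z - transpose_mat Y * X = - (l \<cdot>\<^sub>m 1\<^sub>m m)"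
    and "transpose_mat T * Y - transpose_mat Y * T = 0\<^sub>m m m"
  shows "lambda_symplectic m l (four_block_mat X T Z Y)"
proof -
  let ?S = "four_block_mat X T Z Y" and ?B = "symplectic_form_mat m :: 'a mat"
  have S: "?S \<in> carrier_mat (2 * m) (2 * m)" and B: "?B \<in> carrier_mat (2 * m) (2 * m)"
    unfolding mult_2 symplectic_form_mat_def using carrier by (auto intro: four_block_carrier_mat)
  \<comment> \<open>Left multiplication by the form matrix swaps the two block rows and negates the
    one that moves down.\<close>
  have "?B * ?S = four_block_mat Z Y (- X) (- T)"
    unfolding symplectic_form_mat_def
    by (subst mult_four_block_mat[of _ m m _ m _ m _ _ m _ m]) (use carrier in auto)
  moreover have "transpose_mat ?S * four_block_mat Z Y (- X) (- T) =
    four_block_mat (transpose_mat X * Z - transpose_mat Z * X) (transpose_mat X * Y - transpose_mat Z * T)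
      (transpose_mat T * Z - transpose_mat Y * X) (transpose_mat T * Y - transpose_mat Y * T)"
    unfolding transpose_four_block_mat[OF carrier]
    by (subst mult_four_block_mat[of _ m m _ m _ m _ _ m _ m])
      (use carrier in \<open>auto simp: minus_add_uminus_mat\<close>)
  moreover have "\<dots> = l \<cdot>\<^sub>m ?B"
    unfolding assms(5-8) symplectic_form_mat_def
    by (subst smult_four_block_mat[of _ m m _ m _ m]) auto
  ultimately have "transpose_mat ?S * ?B * ?S = l \<cdot>\<^sub>m ?B"
    using assoc_mult_mat[OF transpose_carrier_mat[THEN iffD2, OF S] B S] by simp
  with S show ?thesis
    by (simp add: lambda_symplectic_def)
qed

section \<open>From the bracket to an alternating form\<close>

context hom_lie_algebra
begin

lemma br_add_left: "br (u + v) w = br u w + br v w"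
  and br_add_right: "br u (v + w) = br u v + br u w"
  and br_scale_left: "br (scale c u) v = scale c (br u v)"
  and br_scale_right: "br u (scale c v) = scale c (br u v)"
  using linear_br_left linear_br_right unfolding linear_iff_module_hom module_hom_iff by auto

lemma \<alpha>_scale: "\<alpha> (scale c v) = scale c (\<alpha> v)"
  using linear_\<alpha> unfolding linear_iff_module_hom module_hom_iff by auto

text \<open>Skew-symmetry gives twice the bracket equal to 0, and 2 is invertible. In characteristic
  2 the theorem takes the alternating property as a hypothesis.\<close>

lemma br_self_if_char_not_2:
  assumes "(2::'k) \<noteq> 0"
  shows "br v v = 0"
proof -
  have "scale 2 (br v v) = br v v + br v v"
    using scale_left_distrib[of 1 1] by simp
  also have "\<dots> = 0"
    using br_skew[of v v] by (simp add: eq_neg_iff_add_eq_0)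
  finally show ?thesis
    using assms by simp
qed

end

text \<open>The derived algebra is a line, so every bracket is a multiple of its generator.
  Coefficients are unique since \<open>z\<close> is nonzero, which transfers bilinearity to them.
  The radical of the form is the center, and this is the same line.\<close>

lemma (in heisenberg_hom_lie_algebra) form_exists:
  assumes self: "\<And>v. br v v = 0"
  obtains z \<omega> where "z \<noteq> 0" and "alternating_form scale \<omega>"
    and "\<And>u v. br u v = scale (\<omega> u v) z" and "{u. \<forall>v. \<omega> u v = 0} = span {z}"
proof -
  obtain z where z: "z \<noteq> 0" "bracket_space UNIV UNIV = span {z}"
    using dim_eq_one_obtains[OF dim_derived] subspace_span unfolding bracket_space_def by blast
  have "br u v \<in> span {z}" for u v
    unfolding z(2)[symmetric] bracket_space_def by (rule span_base) blast
  then have "\<exists>c. br u v = scale c z" for u v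
    by (auto simp: span_singleton)
  then obtain \<omega> where br: "\<And>u v. br u v = scale (\<omega> u v) z"
    by metis
  have cancel: "scale c z = scale d z \<Longrightarrow> c = d" for c d
    using z(1) by simp
  have "alternating_form scale \<omega>"
  proof unfold_locales
    show "\<omega> (u + v) w = \<omega> u w + \<omega> v w" for u v w
      using br_add_left[of u v w] by (intro cancel) (simp add: br scale_left_distrib)
    show "\<omega> u (v + w) = \<omega> u v + \<omega> u w" for u v w
      using br_add_right[of u v w] by (intro cancel) (simp add: br scale_left_distrib)
    show "\<omega> (scale c u) v = c * \<omega> u v" for c u v
      using br_scale_left[of c u v] by (intro cancel) (simp add: br)
    show "\<omega> u (scale c v) = c * \<omega> u v" for c u v
      using br_scale_right[of u c v] by (intro cancel) (simp add: br)
    show "\<omega> v v = 0" for v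
      using self[of v] z(1) by (simp add: br)
  qed
  moreover have "{u. \<forall>v. \<omega> u v = 0} = span {z}"
    using derived_eq_center z by (simp add: center_def br)
  ultimately show ?thesis
    using that z(1) br by blast
qed

section \<open>The adapted basis and the matrix of \<open>\<alpha>\<close>\<close>

theorem theorem3p3:
  fixes scale :: "'k::field \<Rightarrow> 'v::ab_group_add \<Rightarrow> 'v"
    and br :: "'v \<Rightarrow> 'v \<Rightarrow> 'v" and \<alpha> :: "'v \<Rightarrow> 'v"
  assumes heisenberg: "heisenberg_hom_lie_algebra scale br \<alpha>"
    and finite_dim: "\<exists>B. finite_dimensional_vector_space scale B"
    and alternating_if_char_2: "(2::'k) = 0 \<Longrightarrow> \<forall>v. br v v = 0"
  shows "\<exists>(m::nat) (x :: nat \<Rightarrow> 'v) (y :: nat \<Rightarrow> 'v) (z :: 'v) (l :: 'k). m \<ge> 1 \<and>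
    (let bs = map x [0..<m] @ map y [0..<m] @ [z] in
      vector_space.ordered_basis scale bs \<and>
      (\<forall>k<m. br (x k) (y k) = z \<and> z = - br (y k) (x k)) \<and>
      (\<forall>i<m. \<forall>j<m. i \<noteq> j \<longrightarrow> br (x i) (y j) = 0 \<and> br (y i) (x j) = 0) \<and>
      (\<forall>i<m. \<forall>j<m. br (x i) (x j) = 0 \<and> br (y i) (y j) = 0) \<and>
      (\<forall>i<m. br (x i) z = 0 \<and> br z (x i) = 0 \<and> br (y i) z = 0 \<and> br z (y i) = 0) \<and>
      br z z = 0 \<and>
      (\<exists>X \<in> carrier_mat m m. \<exists>T \<in> carrier_mat m m. \<exists>Z \<in> carrier_mat m m. \<exists>Y \<in> carrier_mat m m.
       \<exists>L \<in> carrier_mat 1 m. \<exists>M \<in> carrier_mat 1 m.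
        vector_space.is_matrix_of scale bs \<alpha>
          (four_block_mat (four_block_mat X T Z Y) (0\<^sub>m (2 * m) 1)
             (four_block_mat L M (0\<^sub>m 0 m) (0\<^sub>m 0 m)) (mat 1 1 (\<lambda>_. l))) \<and>
        lambda_symplectic m l (four_block_mat X T Z Y)))"
proof -
  interpret heisenberg_hom_lie_algebra scale br \<alpha>
    by (rule heisenberg)
  have "br v v = 0" for v
    using alternating_if_char_2 br_self_if_char_not_2 by blast
  then obtain z \<omega> where z: "z \<noteq> 0" and form: "alternating_form scale \<omega>"
    and br: "\<And>u v. br u v = scale (\<omega> u v) z" and rad_eq: "{u. \<forall>v. \<omega> u v = 0} = span {z}"
    using form_exists by blast
  interpret alternating_form scale \<omega>
    by (rule form)
  have rad: "\<omega> z v = 0" for v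
    using rad_eq span_base[of z "{z}"] by blast
  have rad': "\<omega> v z = 0" for v
    using rad skew[of v z] by simp
  obtain B where "finite_dimensional_vector_space scale B"
    using finite_dim by blast
  then have "finite B" "span B = UNIV"
    by (auto simp: finite_dimensional_vector_space_def finite_dimensional_vector_space_axioms_def)
  then obtain m x y where fam: "symplectic_family m x y"
    and expand: "\<And>v. \<exists>c. v = family_proj m x y v + scale c z"
    using symplectic_basis_exists[OF _ _ rad_eq z] by metis
  \<comment> \<open>\<open>\<zeta>\<close> picks the \<open>z\<close>-coordinate of each
    vector.\<close>
  from expand obtain \<zeta> where \<zeta>: "\<And>v. v = family_proj m x y v + scale (\<zeta> v) z"
    by metis
  note form_expand = form_expand[OF rad expand]
  have "m \<noteq> 0"
  proof
    assume "m = 0"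
    then have "\<omega> u v = 0" for u v
      using form_expand by simp
    then have "bracket_space UNIV UNIV = span {0}"
      by (simp add: bracket_space_def br)
    then have "dim (bracket_space UNIV UNIV) = card {}"
      using dim_eq_card[of "{}"] by (simp add: independent_empty)
    then show False
      using dim_derived by simp
  qed
  \<comment> \<open>As \<open>z\<close> is itself a bracket, multiplicativity makes its image a
    bracket too, hence a multiple of \<open>z\<close>.\<close>
  then have "z = br (x 0) (y 0)"
    by (simp add: br symplectic_familyD[OF fam])
  then have "\<alpha> z = scale (\<omega> (\<alpha> (x 0)) (\<alpha> (y 0))) z"
    by (metis \<alpha>_br br)
  then have \<alpha>z: "\<omega> (\<alpha> z) v = 0" for v
    by (simp add: scale_left rad)
  \<comment> \<open>Taking \<open>l\<close> as a \<open>z\<close>-coordinate lets the last row of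
    the matrix follow one formula in all columns.\<close>
  define l where "l = \<zeta> (\<alpha> z)"
  have \<alpha>z_eq: "\<alpha> z = scale l z"
    using \<zeta>[of "\<alpha> z"] \<alpha>z by (simp add: family_proj_def l_def)
  \<comment> \<open>Compare the coefficients of \<open>z\<close> after applying
    \<open>\<alpha>\<close> to a bracket.\<close>
  have \<alpha>_form: "\<omega> (\<alpha> u) (\<alpha> v) = l * \<omega> u v" for u v
    using \<alpha>_br[of u v] z by (simp add: br \<alpha>_scale \<alpha>z_eq mult.commute)

  let ?bs = "map x [0..<m] @ map y [0..<m] @ [z]"
  \<comment> \<open>The entries are the coefficients in \<open>family_proj\<close> of the images of
    the \<open>x j\<close> (in \<open>X\<close> and \<open>Z\<close>) and of the \<open>y j\<close>
    (in \<open>T\<close> and \<open>Y\<close>).\<close>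
  define X where "X = mat m m (\<lambda>(i, j). \<omega> (\<alpha> (x j)) (y i))"
  define T where "T = mat m m (\<lambda>(i, j). \<omega> (\<alpha> (y j)) (y i))"
  define Z where "Z = mat m m (\<lambda>(i, j). - \<omega> (\<alpha> (x j)) (x i))"
  define Y where "Y = mat m m (\<lambda>(i, j). - \<omega> (\<alpha> (y j)) (x i))"
  define L where "L = mat 1 m (\<lambda>(i, j). \<zeta> (\<alpha> (x j)))"
  define M where "M = mat 1 m (\<lambda>(i, j). \<zeta> (\<alpha> (y j)))"
  \<comment> \<open>The blocks \<open>0\<^sub>m 0 m\<close> have no rows; they serve to join
    \<open>L\<close> and \<open>M\<close> into one row of length \<open>2 * m\<close>.\<close>
  let ?P = "four_block_mat (four_block_mat X T Z Y) (0\<^sub>m (2 * m) 1)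
    (four_block_mat L M (0\<^sub>m 0 m) (0\<^sub>m 0 m)) (mat 1 1 (\<lambda>_. l))"
  note mats = X_def T_def Z_def Y_def L_def M_def
  have carrier: "X \<in> carrier_mat m m" "T \<in> carrier_mat m m" "Z \<in> carrier_mat m m"
    "Y \<in> carrier_mat m m" "L \<in> carrier_mat 1 m" "M \<in> carrier_mat 1 m"
    by (simp_all add: mats)

  have "is_matrix_of ?bs \<alpha> ?P"
    unfolding is_matrix_of_def
  proof (intro conjI allI impI)
    show "?P \<in> carrier_mat (length ?bs) (length ?bs)"
      by (auto simp: mats)
  next
    fix j assume j: "j < length ?bs"
    define v p where "v = \<alpha> (?bs ! j)" and "p = (\<lambda>i. ?P $$ (i, j))"
    \<comment> \<open>One description covers all three kinds of column; in the last one,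
      \<open>\<alpha>z\<close> accounts for the zeros.\<close>
    then have p: "p i = \<omega> v (y i)" "p (m + i) = - \<omega> v (x i)" "p (m + m) = \<zeta> v" if "i < m" for i
      using that j by (auto simp: mats nth_append less_Suc_eq \<alpha>z l_def)
    have "v = (\<Sum>i<m. scale (\<omega> v (y i)) (x i)) + (\<Sum>i<m. scale (- \<omega> v (x i)) (y i)) + scale (\<zeta> v) z"
      using \<zeta>[of v] unfolding family_proj_def sum.distrib .
    also have "\<dots> = (\<Sum>i<m. scale (p i) (x i)) + (\<Sum>i<m. scale (p (m + i)) (y i)) + scale (p (m + m)) z"
      using \<open>m \<noteq> 0\<close> p by simp
    also have "\<dots> = (\<Sum>i<m + (m + 1). scale (p i) (?bs ! i))"
      unfolding sum_lessThan_add by (simp add: nth_append add.assoc)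
    finally show "\<alpha> (?bs ! j) = (\<Sum>i<length ?bs. scale (?P $$ (i, j)) (?bs ! i))"
      by (simp add: v_def p_def)
  qed
  moreover have "lambda_symplectic m l (four_block_mat X T Z Y)"
  proof -
    \<comment> \<open>Entrywise, each of the four block equations is this identity with
      \<open>u\<close> and \<open>v\<close> taken from \<open>x\<close> or \<open>y\<close>.\<close>
    have form_sum: "(\<Sum>i<m. \<omega> (\<alpha> u) (x i) * \<omega> (\<alpha> v) (y i))
        - (\<Sum>i<m. \<omega> (\<alpha> u) (y i) * \<omega> (\<alpha> v) (x i))
        = l * \<omega> u v" for u v
      using form_expand[of "\<alpha> u" "\<alpha> v"] by (simp add: \<alpha>_form sum_subtractf)
    show ?thesis
    proof (rule lambda_symplectic_four_blockI[OF carrier(1-4)])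
      show "transpose_mat X * Z - transpose_mat Z * X = 0\<^sub>m m m"
        using form_sum[of "x _" "x _"]
        by (intro eq_matI)
          (auto simp: mats scalar_prod_def sum_negf atLeast0LessThan symplectic_familyD[OF fam])
      show "transpose_mat X * Y - transpose_mat Z * T = l \<cdot>\<^sub>m 1\<^sub>m m"
        using form_sum[of "x _" "y _"]
        by (intro eq_matI)
          (auto simp: mats scalar_prod_def sum_negf atLeast0LessThan symplectic_familyD[OF fam])
      show "transpose_mat T * Z - transpose_mat Y * X = - (l \<cdot>\<^sub>m 1\<^sub>m m)"
        using form_sum[of "y _" "x _"]
        by (intro eq_matI)
          (auto simp: mats scalar_prod_def sum_negf atLeast0LessThan symplectic_familyD[OF fam])
      show "transpose_mat T * Y - transpose_mat Y * T = 0\<^sub>m m m"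
        using form_sum[of "y _" "y _"]
        by (intro eq_matI)
          (auto simp: mats scalar_prod_def sum_negf atLeast0LessThan symplectic_familyD[OF fam])
    qed
  qed
  ultimately have matrix: "\<exists>X\<in>carrier_mat m m. \<exists>T\<in>carrier_mat m m. \<exists>Z\<in>carrier_mat m m. \<exists>Y\<in>carrier_mat m m.
      \<exists>L\<in>carrier_mat 1 m. \<exists>M\<in>carrier_mat 1 m.
        is_matrix_of ?bs \<alpha>
          (four_block_mat (four_block_mat X T Z Y) (0\<^sub>m (2 * m) 1)
             (four_block_mat L M (0\<^sub>m 0 m) (0\<^sub>m 0 m)) (mat 1 1 (\<lambda>_. l))) \<and>
        lambda_symplectic m l (four_block_mat X T Z Y)"
    using carrier by blast
  have "\<forall>k<m. br (x k) (y k) = z \<and> z = - br (y k) (x k)"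
    and "\<forall>i<m. \<forall>j<m. i \<noteq> j \<longrightarrow> br (x i) (y j) = 0 \<and> br (y i) (x j) = 0"
    and "\<forall>i<m. \<forall>j<m. br (x i) (x j) = 0 \<and> br (y i) (y j) = 0"
    and "\<forall>i<m. br (x i) z = 0 \<and> br z (x i) = 0 \<and> br (y i) z = 0 \<and> br z (y i) = 0"
    and "br z z = 0"
    by (simp_all add: br rad rad' symplectic_familyD[OF fam])
  moreover have "1 \<le> m"
    using \<open>m \<noteq> 0\<close> by simp
  moreover have "ordered_basis ?bs"
    by (rule ordered_basis_symplectic_family[OF fam rad z expand])
  ultimately show ?thesis
    unfolding Let_def using matrix by blast
qed

end
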